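(* Let $X: I\to Q^2_+$ be a spacelike curve parametrized by arc length $s\in I$. Then $X$ is a self-similar solution to the curvature flow (CF) on $Q^2_+$ if and only if there exist a vector $v\in\mathbb{R}^3_1\setminus\{0\}$ and a constant $c\in\mathbb{R}$ such that $$c+\langle T(s),v\rangle=k(s)\quad\text{for all } s\in I,$$ where $T$ is the unit tangent vector field and $k$ is the curvature of $X$. In particular, $X$ is a soliton solution to the CF whenever $c=0$.
   Context: $\mathbb{R}^3_1$ is $\mathbb{R}^3$ with the Minkowski metric $\langle u,v\rangle=-u_1v_1+u_2v_2+u_3v_3$. The light cone is $Q^2=\{p\in\mathbb{R}^3_1\setminus\{0\}:\langle p,p\rangle=0\}$ and $Q^2_+=\{p\in Q^2:p_1>0\}$. For a (smooth) spacelike curve $X$ on $Q^2$ parametrized by arc length $s$, $T=X'$ is the unit tangent field, $Y(s)$ is the unique lightlike vector orthogonal to $T(s)$ with $\langle X(s),Y(s)\rangle=1$ (the associated curve), and the curvature $k$ is defined by $T'=kX-Y$. For an arbitrary parameter, $T,Y,k$ are those obtained via arc-length reparametrization. A 1-parameter family of spacelike curves $\hat X:I\times J\to Q^2_+$, $J$ an interval containing $0$, with associated curves $\hat Y^t$ and curvatures $\hat k^t$, is a solution to the CF with initial condition $X$ if $\langle \frac{\partial}{\partial t}\hat X^t,\hat Y^t\rangle=\hat k^t$ and $\hat X^0=X$. An isometry of $Q^2_+$ is an element of the Lie group $O_1(3)$ (linear isometries of $\mathbb{R}^3_1$) preserving $Q^2_+$. The curve $X$ is a self-similar solution to the CF if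 there is a solution to the CF of the form $\hat X^t(s)=f(t)M(t)X(s)$, where $f(t)>0$ is smooth with $f(0)=1$ and $M(t)$, $t\in J$, is a smooth family of isometries of $Q^2_+$ with $M(0)=\mathrm{Id}$. If moreover $f\equiv1$, $X$ is a soliton solution. *)

theory Defs
  imports "HOL-Analysis.Analysis"
begin

definition nondegenerate_interval :: "real set \<Rightarrow> bool" where
  "nondegenerate_interval I \<longleftrightarrow> is_interval I \<and> interior I \<noteq> {}"

(* C^n maps on a subset of a finite-dimensional space.  The definition is meant for convex sets
   with nonempty interior (intervals and products of intervals), where derivatives within the
   set are unique; on open sets it is the usual notion.  In finite dimension, continuity of
   f' is the same as continuity of f' in every fixed direction v. *)
primrec Ck_on :: "nat \<Rightarrow> 'a::real_normed_vector set \<Rightarrow> ('a \<Rightarrow> 'b::real_normed_vector) \<Rightarrow> bool" where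
  "Ck_on 0 S f \<longleftrightarrow> continuous_on S f"
| "Ck_on (Suc n) S f \<longleftrightarrow>
     (\<exists>f'. (\<forall>x\<in>S. (f has_derivative f' x) (at x within S)) \<and> (\<forall>v. Ck_on n S (\<lambda>x. f' x v)))"

definition smooth_on :: "'a::real_normed_vector set \<Rightarrow> ('a \<Rightarrow> 'b::real_normed_vector) \<Rightarrow> bool" where
  "smooth_on S f \<longleftrightarrow> (\<forall>n. Ck_on n S f)"

definition minkowski :: "real^3 \<Rightarrow> real^3 \<Rightarrow> real" (\<open>\<langle>_, _\<rangle>\<close>) where
  "\<langle>u, v\<rangle> = - u $ 1 * v $ 1 + u $ 2 * v $ 2 + u $ 3 * v $ 3"

definition light_cone :: "(real^3) set" where
  "light_cone = {p. p \<noteq> 0 \<and> \<langle>p, p\<rangle> = 0}"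

definition future_light_cone :: "(real^3) set" where
  "future_light_cone = {p \<in> light_cone. p $ 1 > 0}"

definition velocity :: "real set \<Rightarrow> (real \<Rightarrow> real^3) \<Rightarrow> real \<Rightarrow> real^3" where
  "velocity I X u = vector_derivative X (at u within I)"

definition spacelike_curve :: "real set \<Rightarrow> (real \<Rightarrow> real^3) \<Rightarrow> bool" where
  "spacelike_curve I X \<longleftrightarrow>
     nondegenerate_interval I \<and> smooth_on I X \<and> X ` I \<subseteq> light_cone \<and>
     (\<forall>u\<in>I. \<langle>velocity I X u, velocity I X u\<rangle> > 0)"

definition arclength_parametrized :: "real set \<Rightarrow> (real \<Rightarrow> real^3) \<Rightarrow> bool" where
  "arclength_parametrized I X \<longleftrightarrow>
     spacelike_curve I X \<and> (\<forall>s\<in>I. \<langle>velocity I X s, velocity I X s\<rangle> = 1)"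

(* The next three are meaningful only when X is parametrized by arc length. *)

definition unit_tangent :: "real set \<Rightarrow> (real \<Rightarrow> real^3) \<Rightarrow> real \<Rightarrow> real^3" where
  "unit_tangent I X s = velocity I X s"

definition associated_curve :: "real set \<Rightarrow> (real \<Rightarrow> real^3) \<Rightarrow> real \<Rightarrow> real^3" where
  "associated_curve I X s =
     (THE y. y \<in> light_cone \<and> \<langle>y, unit_tangent I X s\<rangle> = 0 \<and> \<langle>X s, y\<rangle> = 1)"

definition curvature :: "real set \<Rightarrow> (real \<Rightarrow> real^3) \<Rightarrow> real \<Rightarrow> real" where
  "curvature I X s =
     (THE k. vector_derivative (unit_tangent I X) (at s within I)
               = k *\<^sub>R X s - associated_curve I X s)"

(* Arbitrary parameters: pass to the arc-length reparametrization.  The base point only shifts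
   the arc-length parameter and hence does not affect Y and k. *)

definition arclength :: "real set \<Rightarrow> (real \<Rightarrow> real^3) \<Rightarrow> real \<Rightarrow> real" where
  "arclength I X u =
     (LBINT w=(SOME a. a \<in> I)..u. sqrt \<langle>velocity I X w, velocity I X w\<rangle>)"

definition arclength_reparam :: "real set \<Rightarrow> (real \<Rightarrow> real^3) \<Rightarrow> real \<Rightarrow> real^3" where
  "arclength_reparam I X = X \<circ> the_inv_into I (arclength I X)"

definition associated_curve_param :: "real set \<Rightarrow> (real \<Rightarrow> real^3) \<Rightarrow> real \<Rightarrow> real^3" where
  "associated_curve_param I X u =
     associated_curve (arclength I X ` I) (arclength_reparam I X) (arclength I X u)"

definition curvature_param :: "real set \<Rightarrow> (real \<Rightarrow> real^3) \<Rightarrow> real \<Rightarrow> real" where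
  "curvature_param I X u =
     curvature (arclength I X ` I) (arclength_reparam I X) (arclength I X u)"

(* In a family, Xh t is the curve at time t. *)
definition CF_solution ::
  "real set \<Rightarrow> real set \<Rightarrow> (real \<Rightarrow> real^3) \<Rightarrow> (real \<Rightarrow> real \<Rightarrow> real^3) \<Rightarrow> bool" where
  "CF_solution I J X Xh \<longleftrightarrow>
     nondegenerate_interval J \<and> 0 \<in> J \<and>
     smooth_on (I \<times> J) (\<lambda>(u, t). Xh t u) \<and>
     (\<forall>t\<in>J. spacelike_curve I (Xh t) \<and> Xh t ` I \<subseteq> future_light_cone) \<and>
     (\<forall>t\<in>J. \<forall>u\<in>I.
        \<langle>vector_derivative (\<lambda>\<tau>. Xh \<tau> u) (at t within J), associated_curve_param I (Xh t) u\<rangle>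
          = curvature_param I (Xh t) u) \<and>
     (\<forall>u\<in>I. Xh 0 u = X u)"

definition O13 :: "(real^3^3) set" where
  "O13 = {M. \<forall>u v. \<langle>M *v u, M *v v\<rangle> = \<langle>u, v\<rangle>}"

definition future_cone_isometries :: "(real^3^3) set" where
  "future_cone_isometries = {M \<in> O13. (\<lambda>p. M *v p) ` future_light_cone = future_light_cone}"

definition self_similar_motion ::
  "real set \<Rightarrow> (real \<Rightarrow> real^3) \<Rightarrow> real set \<Rightarrow> (real \<Rightarrow> real) \<Rightarrow> (real \<Rightarrow> real^3^3) \<Rightarrow> bool" where
  "self_similar_motion I X J f M \<longleftrightarrow>
     smooth_on J f \<and> (\<forall>t\<in>J. f t > 0) \<and> f 0 = 1 \<and>
     smooth_on J M \<and> (\<forall>t\<in>J. M t \<in> future_cone_isometries) \<and> M 0 = mat 1 \<and>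
     CF_solution I J X (\<lambda>t s. f t *\<^sub>R (M t *v X s))"

definition self_similar_solution :: "real set \<Rightarrow> (real \<Rightarrow> real^3) \<Rightarrow> bool" where
  "self_similar_solution I X \<longleftrightarrow> (\<exists>J f M. self_similar_motion I X J f M)"

definition soliton_solution :: "real set \<Rightarrow> (real \<Rightarrow> real^3) \<Rightarrow> bool" where
  "soliton_solution I X \<longleftrightarrow>
     (\<exists>J f M. self_similar_motion I X J f M \<and> (\<forall>t\<in>J. f t = 1))"

end

theory Submission
  imports Defs
begin

text \<open>A curve \<open>f M X\<close> with \<open>M\<close> a Lorentz map has associated curve \<open>M Y / f\<close> and curvature
  \<open>k / f\<^sup>2\<close>, so \<open>f(t) M(t) X\<close> solves the flow iff \<open>f f' + f\<^sup>2 \<langle>M' X, M Y\<rangle> = k\<close>. At \<open>t = 0\<close> the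
  matrix \<open>M'(0)\<close> is skew, hence a Lorentzian cross product with some vector \<open>w\<close>, and
  \<open>\<langle>w \<times> X, Y\<rangle> = D \<langle>T, w\<rangle>\<close>, where the volume \<open>D = \<plusminus>1\<close> of the frame \<open>(X, T, Y)\<close> is constant along the
  curve. If \<open>w = 0\<close>, then \<open>k\<close> is constant and \<open>k X + Y\<close> is a constant vector orthogonal to \<open>T\<close>.
  Conversely, put \<open>A = w \<times> _\<close> with \<open>w = D v\<close>; then \<open>f = sqrt (1 + 2 c t)\<close> and \<open>M = exp (g A)\<close> with
  \<open>g' = 1 / f\<^sup>2\<close> solve the flow. Since \<open>A\<^sup>3 = \<langle>w, w\<rangle> A\<close>, the exponential is a quadratic polynomial
  in \<open>A\<close>.\<close>

section \<open>Calculus of smooth maps\<close>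

lemma Ck_on_Suc_imp_Ck_on: "Ck_on (Suc n) S f \<Longrightarrow> Ck_on n S f"
proof (induction n arbitrary: f)
  case 0
  then show ?case
    by (auto simp: continuous_on_eq_continuous_within intro: has_derivative_continuous)
next
  case (Suc n)
  then show ?case by (metis Ck_on.simps(2))
qed

lemma Ck_on_cong:
  assumes "\<And>x. x \<in> S \<Longrightarrow> f x = g x"
  shows "Ck_on n S f \<Longrightarrow> Ck_on n S g"
proof (cases n)
  case 0
  then show "Ck_on n S f \<Longrightarrow> Ck_on n S g" using assms by (simp cong: continuous_on_cong)
next
  case (Suc m)
  then show "Ck_on n S f \<Longrightarrow> Ck_on n S g"
    using assms by (simp, metis has_derivative_transform)
qed

lemma Ck_on_const: "Ck_on n S (\<lambda>x. c)"
proof (induction n arbitrary: c)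
  case (Suc n)
  then show ?case by (auto intro!: exI[of _ "\<lambda>x v. 0"])
qed simp

lemma Ck_on_add: "Ck_on n S f \<Longrightarrow> Ck_on n S g \<Longrightarrow> Ck_on n S (\<lambda>x. f x + g x)"
proof (induction n arbitrary: f g)
  case 0
  then show ?case by (auto intro: continuous_on_add)
next
  case (Suc n)
  then obtain f' g' where "\<forall>x\<in>S. (f has_derivative f' x) (at x within S)"
    "\<forall>v. Ck_on n S (\<lambda>x. f' x v)" "\<forall>x\<in>S. (g has_derivative g' x) (at x within S)"
    "\<forall>v. Ck_on n S (\<lambda>x. g' x v)"
    by auto
  then show ?case
    by (auto intro!: exI[of _ "\<lambda>x v. f' x v + g' x v"] has_derivative_add Suc.IH)
qed

lemma (in bounded_bilinear) Ck_on:
  "Ck_on n S f \<Longrightarrow> Ck_on n S g \<Longrightarrow> Ck_on n S (\<lambda>x. prod (f x) (g x))"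
proof (induction n arbitrary: f g)
  case 0
  then show ?case by (auto intro: continuous_on)
next
  case (Suc n)
  then obtain f' g' where d: "\<forall>x\<in>S. (f has_derivative f' x) (at x within S)"
    "\<forall>v. Ck_on n S (\<lambda>x. f' x v)" "\<forall>x\<in>S. (g has_derivative g' x) (at x within S)"
    "\<forall>v. Ck_on n S (\<lambda>x. g' x v)"
    by auto
  \<comment> \<open>The product rule leaves one factor undifferentiated in each summand, so the
    induction hypothesis also needs the factors themselves in class C^n.\<close>
  have "Ck_on n S f" "Ck_on n S g" using Suc.prems by (blast intro: Ck_on_Suc_imp_Ck_on)+
  then show ?case
    using d by (auto intro!: exI[of _ "\<lambda>x v. prod (f x) (g' x v) + prod (f' x v) (g x)"] FDERIV Ck_on_add Suc.IH)
qed

lemmas Ck_on_scaleR = bounded_bilinear.Ck_on[OF bounded_bilinear_scaleR]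
  and Ck_on_mult = bounded_bilinear.Ck_on[OF bounded_bilinear_mult]

lemma (in bounded_linear) Ck_on: "Ck_on n S g \<Longrightarrow> Ck_on n S (\<lambda>x. f (g x))"
proof (induction n arbitrary: g)
  case 0
  then show ?case by (auto intro: continuous_on)
next
  case (Suc n)
  then obtain g' where "\<forall>x\<in>S. (g has_derivative g' x) (at x within S)"
    "\<forall>v. Ck_on n S (\<lambda>x. g' x v)"
    by auto
  then show ?case
    by (auto intro!: exI[of _ "\<lambda>x v. f (g' x v)"] has_derivative Suc.IH)
qed

text \<open>An inner linear map is its own derivative, so differentiating the composition only
  changes the direction to the constant \<open>f v\<close>, and the induction repeats. The
  projections of \<open>I \<times> J\<close> are the intended inner maps.\<close>

lemma (in bounded_linear) Ck_on_compose:
  assumes "f ` S \<subseteq> U"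
  shows "Ck_on n U g \<Longrightarrow> Ck_on n S (\<lambda>x. g (f x))"
proof (induction n arbitrary: g)
  case 0
  then show ?case
    using assms by (auto intro!: continuous_on_compose2[of U g] continuous_on continuous_on_id)
next
  case (Suc n)
  then obtain g' where g: "\<forall>x\<in>U. (g has_derivative g' x) (at x within U)"
    "\<forall>v. Ck_on n U (\<lambda>x. g' x v)"
    by auto
  have "((\<lambda>x. g (f x)) has_derivative (\<lambda>v. g' (f x) (f v))) (at x within S)" if "x \<in> S" for x
  proof (rule has_derivative_in_compose2[of U])
    show "(f has_derivative f) (at x within S)"
      by (rule has_derivative[OF has_derivative_ident])
  qed (use g assms that in auto)
  moreover have "Ck_on n S (\<lambda>x. g' (f x) (f v))" for v
    using g(2) by (intro Suc.IH) blast
  ultimately show ?case by (auto intro!: exI[of _ "\<lambda>x v. g' (f x) (f v)"])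
qed

lemma Ck_on_SucI:
  assumes "\<And>t. t \<in> J \<Longrightarrow> (f has_vector_derivative f' t) (at t within J)" "Ck_on n J f'"
  shows "Ck_on (Suc n) J f"
  using assms by (auto intro!: exI[of _ "\<lambda>t h. h *\<^sub>R f' t"] Ck_on_scaleR Ck_on_const
      simp: has_vector_derivative_def)

section \<open>Derivatives within nondegenerate intervals, endpoints included\<close>

lemma nondegenerate_interval_at_neq_bot:
  assumes "nondegenerate_interval I" "s \<in> I"
  shows "at s within I \<noteq> bot"
proof -
  have "connected I" "\<nexists>x. I = {x}"
    using assms by (auto simp: nondegenerate_interval_def is_interval_connected)
  then show ?thesis
    using assms connected_imp_perfect by (auto simp: trivial_limit_within)
qed

lemma smooth_on_has_vector_derivative:
  assumes "smooth_on I X" "nondegenerate_interval I" "s \<in> I"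
  shows "(X has_vector_derivative vector_derivative X (at s within I)) (at s within I)"
proof -
  have "Ck_on (Suc 0) I X" using assms(1) unfolding smooth_on_def by blast
  then have "X differentiable (at s within I)"
    using assms(3) by (auto simp: differentiable_def)
  then show ?thesis
    using vector_derivative_works nondegenerate_interval_at_neq_bot[OF assms(2,3)] by blast
qed

text \<open>A linear map on the reals is determined by its value at 1, so the derivative in
  direction 1 provided by \<open>Ck_on\<close> is the vector derivative.\<close>

lemma smooth_on_vector_derivative:
  assumes "smooth_on I X" "nondegenerate_interval I"
  shows "smooth_on I (\<lambda>s. vector_derivative X (at s within I))"
  unfolding smooth_on_def
proof
  fix n
  have "Ck_on (Suc n) I X" using assms(1) unfolding smooth_on_def by blast
  then obtain X' where X': "\<forall>x\<in>I. (X has_derivative X' x) (at x within I)"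
    "Ck_on n I (\<lambda>x. X' x 1)"
    by auto
  have "X' s 1 = vector_derivative X (at s within I)" if "s \<in> I" for s
  proof -
    have "(X has_derivative X' s) (at s within I)" using X' that by auto
    moreover from this have "X' s = (\<lambda>h. h *\<^sub>R X' s 1)"
      by (metis has_derivative_bounded_linear linear_simps(5) mult.right_neutral
          real_scaleR_def ext)
    ultimately have "(X has_vector_derivative X' s 1) (at s within I)"
      by (metis has_vector_derivative_def)
    then show ?thesis
      using vector_derivative_within[OF nondegenerate_interval_at_neq_bot[OF assms(2) that]]
      by metis
  qed
  then show "Ck_on n I (\<lambda>s. vector_derivative X (at s within I))"
    by (rule Ck_on_cong[OF _ X'(2)])
qed

text \<open>The substitution \<open>\<sigma> / c + a\<close> inverts the arc length, measured from
  \<open>a\<close>, of a curve of constant speed \<open>c\<close>.\<close>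

lemma has_vector_derivative_rescale:
  assumes "(F has_vector_derivative F') (at (\<sigma> / c + a) within I)" "(\<lambda>\<sigma>. \<sigma> / c + a) ` L \<subseteq> I"
  shows "((\<lambda>\<sigma>. F (\<sigma> / c + a)) has_vector_derivative (1 / c) *\<^sub>R F') (at \<sigma> within L)"
proof -
  have "((\<lambda>\<sigma>. \<sigma> / c + a) has_vector_derivative 1 / c) (at \<sigma> within L)"
    unfolding has_real_derivative_iff_has_vector_derivative[symmetric]
    using DERIV_add[OF DERIV_cdivide[OF DERIV_ident] DERIV_const] by simp
  from vector_diff_chain_within[OF this has_vector_derivative_within_subset[OF assms]]
  show ?thesis by (simp add: o_def)
qed

section \<open>Minkowski geometry\<close>

interpretation minkowski: bounded_bilinear minkowski
proof -
  have "bilinear minkowski"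
    unfolding bilinear_def minkowski_def
    by (auto intro!: linearI simp: algebra_simps)
  then show "bounded_bilinear minkowski" by (simp add: bilinear_conv_bounded_bilinear)
qed

lemmas minkowski_simps = minkowski.add_left minkowski.add_right minkowski.diff_left
  minkowski.diff_right minkowski.scaleR_left minkowski.scaleR_right minkowski.minus_left
  minkowski.minus_right

lemma minkowski_commute: "\<langle>u, v\<rangle> = \<langle>v, u\<rangle>"
  by (simp add: minkowski_def mult.commute)

lemma minkowski_nondegenerate:
  assumes "\<And>w. \<langle>d, w\<rangle> = 0"
  shows "d = 0"
  using assms[of "axis 1 1"] assms[of "axis 2 1"] assms[of "axis 3 1"]
  by (simp add: minkowski_def vec_eq_iff forall_3 axis_def)

section \<open>The Lorentzian cross product\<close>

text \<open>The Euclidean cross product with its first component negated, so that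
  \<open>\<langle>lorentz_cross u w, x\<rangle>\<close> is the determinant of \<open>u\<close>,
  \<open>w\<close>, \<open>x\<close>.\<close>

definition lorentz_cross :: "real^3 \<Rightarrow> real^3 \<Rightarrow> real^3" where
  "lorentz_cross u w =
     vector [- (u$2 * w$3 - u$3 * w$2), u$3 * w$1 - u$1 * w$3, u$1 * w$2 - u$2 * w$1]"

lemma linear_lorentz_cross: "linear (lorentz_cross w)"
  by (auto intro!: linearI simp: lorentz_cross_def vec_eq_iff forall_3 algebra_simps)

lemma lorentz_cross_skew: "\<langle>lorentz_cross w x, y\<rangle> = - \<langle>x, lorentz_cross w y\<rangle>"
  by (simp add: lorentz_cross_def minkowski_def algebra_simps)

text \<open>Cayley-Hamilton for a skew map in dimension three, whose characteristic polynomial has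
  only odd terms.\<close>

lemma lorentz_cross_cube:
  "lorentz_cross w (lorentz_cross w (lorentz_cross w x)) = \<langle>w, w\<rangle> *\<^sub>R lorentz_cross w x"
  by (simp add: lorentz_cross_def minkowski_def vec_eq_iff forall_3 algebra_simps)

text \<open>Skewness on the pairs of basis vectors clears the diagonal and leaves three free
  entries. Comparing the entries above the diagonal with the matrix of
  \<open>lorentz_cross w\<close> gives \<open>w\<close>.\<close>

lemma skew_imp_lorentz_cross:
  assumes "\<And>x y. \<langle>A *v x, y\<rangle> = - \<langle>x, A *v y\<rangle>"
  obtains w where "\<And>x. A *v x = lorentz_cross w x"
proof
  show "A *v x = lorentz_cross (vector [- A$2$3, - A$1$3, A$1$2]) x" for x
    using assms[of "axis 1 1" "axis 1 1"] assms[of "axis 2 1" "axis 2 1"] 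
      assms[of "axis 3 1" "axis 3 1"] assms[of "axis 1 1" "axis 2 1"] 
      assms[of "axis 1 1" "axis 3 1"] assms[of "axis 2 1" "axis 3 1"]
    by (simp add: lorentz_cross_def minkowski_def matrix_vector_mult_def sum_3 axis_def
        vec_eq_iff forall_3 algebra_simps)
qed

section \<open>Null frames\<close>

definition null_frame :: "real^3 \<Rightarrow> real^3 \<Rightarrow> real^3 \<Rightarrow> bool" where
  "null_frame X T Y \<longleftrightarrow> \<langle>X, X\<rangle> = 0 \<and> \<langle>Y, Y\<rangle> = 0 \<and> \<langle>T, T\<rangle> = 1
     \<and> \<langle>X, T\<rangle> = 0 \<and> \<langle>Y, T\<rangle> = 0 \<and> \<langle>X, Y\<rangle> = 1"

text \<open>The metric has determinant -1, so the squared determinant of three vectors is minus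
  their Gram determinant, which is -1 for a null frame.\<close>

lemma null_frame_volume:
  assumes "null_frame X T Y"
  shows "\<langle>lorentz_cross X T, Y\<rangle>\<^sup>2 = 1"
proof -
  have gram: "\<langle>lorentz_cross X T, Y\<rangle>\<^sup>2 = - (\<langle>X, X\<rangle> * \<langle>T, T\<rangle> * \<langle>Y, Y\<rangle> + 2 * \<langle>X, T\<rangle> * \<langle>Y, T\<rangle> * \<langle>X, Y\<rangle>
      - \<langle>X, X\<rangle> * \<langle>Y, T\<rangle>\<^sup>2 - \<langle>T, T\<rangle> * \<langle>X, Y\<rangle>\<^sup>2 - \<langle>Y, Y\<rangle> * \<langle>X, T\<rangle>\<^sup>2)"
    by (simp add: lorentz_cross_def minkowski_def) algebra
  show ?thesis
    using assms unfolding gram by (simp add: null_frame_def)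
qed

text \<open>By Cramer's rule the volume of the frame times \<open>d\<close> is a combination of
  cross products whose coefficients are the three vanishing pairings, and the volume is not
  zero.\<close>

lemma null_frame_orthogonal_imp_zero:
  assumes "null_frame X T Y" "\<langle>d, X\<rangle> = 0" "\<langle>d, T\<rangle> = 0" "\<langle>d, Y\<rangle> = 0"
  shows "d = 0"
proof -
  have cramer: "\<langle>lorentz_cross X T, Y\<rangle> * \<langle>d, w\<rangle> = \<langle>d, X\<rangle> * \<langle>lorentz_cross T Y, w\<rangle>
      + \<langle>d, T\<rangle> * \<langle>lorentz_cross Y X, w\<rangle> + \<langle>d, Y\<rangle> * \<langle>lorentz_cross X T, w\<rangle>" for w
    by (simp add: lorentz_cross_def minkowski_def algebra_simps)
  have "\<langle>d, w\<rangle> = 0" for w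
    using cramer[of w] null_frame_volume[OF assms(1)] assms(2-) by auto
  then show ?thesis by (rule minkowski_nondegenerate)
qed

text \<open>Two candidates differ by a multiple of \<open>X\<close>. Since \<open>Y'\<close> is
  lightlike and pairs to 1 with \<open>X\<close>, this multiple is zero. It makes the associated
  curve well defined.\<close>

lemma null_frame_unique:
  assumes "null_frame X T Y" "null_frame X T Y'"
  shows "Y' = Y"
proof -
  have "Y' - Y - \<langle>Y', Y\<rangle> *\<^sub>R X = 0"
    using assms by (intro null_frame_orthogonal_imp_zero[OF assms(1)])
      (auto simp: null_frame_def minkowski_simps minkowski_commute)
  then have Y': "Y' = Y + \<langle>Y', Y\<rangle> *\<^sub>R X" by (simp add: algebra_simps)
  have "0 = \<langle>Y', Y + \<langle>Y', Y\<rangle> *\<^sub>R X\<rangle>"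
    using assms(2) Y' by (simp add: null_frame_def)
  also have "\<dots> = 2 * \<langle>Y', Y\<rangle>"
    using assms(2) by (simp add: null_frame_def minkowski_simps minkowski_commute)
  finally show ?thesis using Y' by simp
qed

text \<open>Expand \<open>w\<close> in the frame: the components along \<open>X\<close> and
  \<open>Y\<close> produce determinants with a repeated vector, so only the one along
  \<open>T\<close> survives.\<close>

lemma null_frame_lorentz_cross:
  assumes "null_frame X T Y"
  shows "\<langle>lorentz_cross w X, Y\<rangle> = - \<langle>lorentz_cross X T, Y\<rangle> * \<langle>T, w\<rangle>"
proof -
  have "w - \<langle>w, Y\<rangle> *\<^sub>R X - \<langle>w, T\<rangle> *\<^sub>R T - \<langle>w, X\<rangle> *\<^sub>R Y = 0"
    using assms by (intro null_frame_orthogonal_imp_zero[OF assms(1)])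
      (auto simp: null_frame_def minkowski_simps minkowski_commute)
  then have w: "w = \<langle>w, Y\<rangle> *\<^sub>R X + \<langle>T, w\<rangle> *\<^sub>R T + \<langle>w, X\<rangle> *\<^sub>R Y"
    by (simp add: algebra_simps minkowski_commute)
  have "\<langle>lorentz_cross (a *\<^sub>R X + b *\<^sub>R T + c *\<^sub>R Y) X, Y\<rangle> = - \<langle>lorentz_cross X T, Y\<rangle> * b"
    for a b c
    by (simp add: lorentz_cross_def minkowski_def algebra_simps)
  then show ?thesis using w by metis
qed

lemma lorentz_cross_orthogonal: "\<langle>lorentz_cross u w, u\<rangle> = 0"
  by (simp add: lorentz_cross_def minkowski_def algebra_simps)

lemma bounded_bilinear_lorentz_cross: "bounded_bilinear lorentz_cross"
proof -
  have "bilinear lorentz_cross"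
    unfolding bilinear_def
    by (auto intro!: linearI simp: lorentz_cross_def vec_eq_iff forall_3 algebra_simps)
  then show ?thesis by (simp add: bilinear_conv_bounded_bilinear)
qed

lemma bounded_bilinear_matrix_vector_mult:
  "bounded_bilinear ((*v) :: real^'n^'m \<Rightarrow> real^'n \<Rightarrow> real^'m)"
proof -
  have "bilinear ((*v) :: real^'n^'m \<Rightarrow> real^'n \<Rightarrow> real^'m)"
    unfolding bilinear_def
    by (auto intro!: linearI simp: algebra_simps scaleR_matrix_vector_assoc)
  then show ?thesis by (simp add: bilinear_conv_bounded_bilinear)
qed

section \<open>Lorentz maps and the two halves of the light cone\<close>

lemma light_cone_time_component_neq_0: "p \<in> light_cone \<Longrightarrow> p $ 1 \<noteq> 0"
  by (auto simp: light_cone_def minkowski_def vec_eq_iff forall_3 add_nonneg_eq_0_iff)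

lemma O13_minkowski: "M \<in> O13 \<Longrightarrow> \<langle>M *v x, M *v y\<rangle> = \<langle>x, y\<rangle>"
  by (simp add: O13_def)

lemma O13_mult_eq_0: "M \<in> O13 \<Longrightarrow> M *v x = 0 \<Longrightarrow> x = 0"
  by (metis O13_minkowski minkowski.zero_left minkowski_nondegenerate)

lemma O13_light_cone:
  assumes "M \<in> O13" "c \<noteq> 0" "p \<in> light_cone"
  shows "c *\<^sub>R (M *v p) \<in> light_cone"
  using assms O13_mult_eq_0 by (auto simp: light_cone_def minkowski_simps O13_minkowski)

text \<open>Along a path starting at the identity, the time component of \<open>M t *v p\<close>
  never vanishes and is positive at 0, hence stays positive by connectedness.\<close>

lemma O13_path_future_cone_isometry:
  assumes O: "\<And>t. t \<in> J \<Longrightarrow> M t \<in> O13" and M: "continuous_on J M" "M 0 = mat 1"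
    and J: "connected J" "0 \<in> J" "t \<in> J"
  shows "M t \<in> future_cone_isometries"
proof -
  have future: "M t *v p \<in> future_light_cone" if p: "p \<in> future_light_cone" for p
  proof -
    define h where "h \<tau> = (M \<tau> *v p) $ 1" for \<tau>
    have cone: "M \<tau> *v p \<in> light_cone" if "\<tau> \<in> J" for \<tau>
      using O13_light_cone[OF O[OF that], of 1 p] p by (simp add: future_light_cone_def)
    have "continuous_on J h"
      unfolding h_def
      by (intro continuous_on_component bounded_bilinear.continuous_on[OF
            bounded_bilinear_matrix_vector_mult] M continuous_on_const)
    then have "connected (h ` J)"
      using J(1) connected_continuous_image by blast
    moreover have "h 0 > 0"
      using M p by (simp add: h_def future_light_cone_def)
    moreover have "0 \<notin> h ` J"
      using cone light_cone_time_component_neq_0 by (force simp: h_def)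
    ultimately have "h t > 0"
      using connectedD_interval[of "h ` J" "h t" "h 0" 0] J(2,3) by (meson imageI less_imp_le not_le)
    then show ?thesis using cone[OF J(3)] by (simp add: future_light_cone_def h_def)
  qed
  \<comment> \<open>Surjectivity onto the future cone: if the linear preimage \<open>q\<close> were
    in the past cone, \<open>- q\<close> would be mapped to \<open>- p\<close>, which would then be
    future.\<close>
  have "p \<in> (\<lambda>p. M t *v p) ` future_light_cone" if p: "p \<in> future_light_cone" for p
  proof -
    have "inj (\<lambda>p. M t *v p)"
      using O13_mult_eq_0[OF O[OF J(3)]]
      by (simp add: linear_injective_0)
    then have "surj (\<lambda>p. M t *v p)"
      by (simp add: linear_injective_imp_surjective)
    then obtain q where q: "p = M t *v q" by (metis surjD)
    then have "q \<in> light_cone"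
      using p O13_minkowski[OF O[OF J(3)], of q q] by (auto simp: future_light_cone_def light_cone_def)
    moreover from this have "- q \<in> light_cone"
      by (simp add: light_cone_def minkowski_simps)
    moreover have "\<not> q $ 1 < 0"
    proof
      assume "q $ 1 < 0"
      then have "M t *v (- q) \<in> future_light_cone"
        using \<open>- q \<in> light_cone\<close> by (intro future) (simp add: future_light_cone_def)
      moreover have "M t *v (- q) = - p"
        unfolding q using matrix_vector_mult_scaleR[of "M t" "-1" q] by simp
      ultimately show False using p by (simp add: future_light_cone_def)
    qed
    ultimately have "q \<in> future_light_cone"
      using light_cone_time_component_neq_0[of q] by (simp add: future_light_cone_def)
    then show ?thesis using q by blast
  qed
  then show ?thesis
    using future O[OF J(3)] by (auto simp: future_cone_isometries_def)
qed

section \<open>Coefficients of the motion\<close>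

text \<open>\<open>\<phi>\<close> and \<open>\<psi>\<close> are the coefficients in \<open>exp (\<tau> A) = 1 + \<phi> \<tau> A + \<psi> \<tau> A\<^sup>2\<close> for \<open>A\<^sup>3 = q A\<close>; the
  conserved quantity expresses that this exponential is a Lorentz transformation.\<close>

lemma exists_exponential_coefficients:
  fixes q :: real
  obtains \<phi> \<psi> where "\<And>\<tau>. (\<phi> has_real_derivative 1 + q * \<psi> \<tau>) (at \<tau>)"
    "\<And>\<tau>. (\<psi> has_real_derivative \<phi> \<tau>) (at \<tau>)" "\<phi> 0 = 0" "\<psi> 0 = 0"
    "\<And>\<tau>. 2 * \<psi> \<tau> - (\<phi> \<tau>)\<^sup>2 + q * (\<psi> \<tau>)\<^sup>2 = 0"
\<comment> \<open>The system amounts to \<open>\<psi>'' = 1 + q \<psi>\<close> with zero initial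
  data; the sign of \<open>q\<close> decides between trigonometric, polynomial and hyperbolic
  solutions.\<close>
proof (cases q "0 :: real" rule: linorder_cases)
  case less
  define r where "r = sqrt (- q)"
  have r: "r > 0" "q = - r\<^sup>2" using less by (auto simp: r_def)
  show ?thesis
  proof (rule that[of "\<lambda>\<tau>. sin (r * \<tau>) / r" "\<lambda>\<tau>. (1 - cos (r * \<tau>)) / r\<^sup>2"])
    show "2 * ((1 - cos (r * \<tau>)) / r\<^sup>2) - (sin (r * \<tau>) / r)\<^sup>2
        + q * ((1 - cos (r * \<tau>)) / r\<^sup>2)\<^sup>2 = 0" for \<tau>
      using r(1) unfolding r(2) power_divide sin_squared_eq
      by (simp add: field_simps power2_eq_square)
  qed (use r(1) in \<open>auto intro!: derivative_eq_intros simp: r(2) power2_eq_square\<close>)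
next
  case equal
  show ?thesis
    by (rule that[of "\<lambda>\<tau>. \<tau>" "\<lambda>\<tau>. \<tau>\<^sup>2 / 2"]) (auto intro!: derivative_eq_intros simp: equal)
next
  case greater
  define r where "r = sqrt q"
  have r: "r > 0" "q = r\<^sup>2" using greater by (auto simp: r_def)
  show ?thesis
  proof (rule that[of "\<lambda>\<tau>. sinh (r * \<tau>) / r" "\<lambda>\<tau>. (cosh (r * \<tau>) - 1) / r\<^sup>2"])
    show "2 * ((cosh (r * \<tau>) - 1) / r\<^sup>2) - (sinh (r * \<tau>) / r)\<^sup>2
        + q * ((cosh (r * \<tau>) - 1) / r\<^sup>2)\<^sup>2 = 0" for \<tau>
      using r(1) unfolding r(2) power_divide sinh_square_eq
      by (simp add: field_simps power2_eq_square)
  qed (use r(1) in \<open>auto intro!: derivative_eq_intros simp: r(2) power2_eq_square\<close>)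
qed

text \<open>The scaling solves \<open>f f' = c\<close>, and \<open>a\<close>, \<open>b\<close> are
  the exponential coefficients at a rescaled time \<open>g\<close> with
  \<open>g' = 1 / f\<^sup>2\<close>. All derivatives are written as polynomials in
  \<open>1 / f\<close>, \<open>a\<close>, \<open>b\<close>, as the regularity argument
  requires.\<close>

lemma exists_motion_coefficients:
  fixes c q :: real
  obtains J f a b where "nondegenerate_interval J" "0 \<in> J" "\<And>t. t \<in> J \<Longrightarrow> f t > 0"
    "f 0 = 1" "a 0 = 0" "b 0 = 0" "c = 0 \<Longrightarrow> \<forall>t\<in>J. f t = 1"
    "\<And>t. t \<in> J \<Longrightarrow> 2 * b t - (a t)\<^sup>2 + q * (b t)\<^sup>2 = 0"
    "\<And>t. t \<in> J \<Longrightarrow> (f has_vector_derivative c * (1 / f t)) (at t within J)"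
    "\<And>t. t \<in> J \<Longrightarrow>
        (a has_vector_derivative (1 + q * b t) * ((1 / f t) * (1 / f t))) (at t within J)"
    "\<And>t. t \<in> J \<Longrightarrow> (b has_vector_derivative a t * ((1 / f t) * (1 / f t))) (at t within J)"
proof -
  obtain \<phi> \<psi> where d\<phi>: "\<And>\<tau>. (\<phi> has_real_derivative 1 + q * \<psi> \<tau>) (at \<tau>)"
    and d\<psi>: "\<And>\<tau>. (\<psi> has_real_derivative \<phi> \<tau>) (at \<tau>)" and init: "\<phi> 0 = 0" "\<psi> 0 = 0"
    and inv: "\<And>\<tau>. 2 * \<psi> \<tau> - (\<phi> \<tau>)\<^sup>2 + q * (\<psi> \<tau>)\<^sup>2 = 0"
    by (rule exists_exponential_coefficients[of q]) blast
  \<comment> \<open>The radius forces \<open>2 * \<bar>c * t\<bar> < 1\<close>, which keeps the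
    radicand of \<open>f\<close> positive.\<close>
  define J where "J = ball (0 :: real) (1 / (2 * (\<bar>c\<bar> + 1)))"
  define f where "f t = sqrt (1 + 2 * c * t)" for t
  \<comment> \<open>The antiderivative of \<open>1 / (1 + 2 * c * t)\<close> vanishing at 0; for
    \<open>c = 0\<close> the logarithmic formula would divide by zero.\<close>
  define g where "g t = (if c = 0 then t else ln (1 + 2 * c * t) / (2 * c))" for t
  have pos: "1 + 2 * c * t > 0" if "t \<in> J" for t
  proof -
    have "\<bar>t\<bar> < 1 / (2 * (\<bar>c\<bar> + 1))" using that by (simp add: J_def)
    then have "\<bar>t\<bar> * (2 * (\<bar>c\<bar> + 1)) < 1" by (simp add: pos_less_divide_eq)
    then have "2 * \<bar>c * t\<bar> < 1" by (simp add: abs_mult algebra_simps)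
    then show ?thesis by (simp add: abs_if split: if_splits)
  qed
  have f: "(f has_real_derivative c * (1 / f t)) (at t within J)" if "t \<in> J" for t
    unfolding f_def using pos[OF that] by (auto intro!: derivative_eq_intros simp: field_simps)
  have g: "(g has_real_derivative (1 / f t) * (1 / f t)) (at t within J)" if "t \<in> J" for t
  proof (cases "c = 0")
    case True
    then have "g = (\<lambda>t. t)" "f t = 1" by (auto simp: g_def f_def)
    then show ?thesis by simp
  next
    case False
    have "((\<lambda>t. ln (1 + 2 * c * t) / (2 * c)) has_real_derivative 1 / (1 + 2 * c * t))
        (at t within J)"
      using pos[OF that] False by (auto intro!: derivative_eq_intros)
    moreover have "(1 / f t) * (1 / f t) = 1 / (1 + 2 * c * t)"
      using pos[OF that] by (simp add: f_def)
    moreover have "g = (\<lambda>t. ln (1 + 2 * c * t) / (2 * c))"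
      using False by (auto simp: g_def)
    ultimately show ?thesis by simp
  qed
  have g0: "g 0 = 0" by (simp add: g_def)
  show thesis
  proof (rule that[of J f "\<lambda>t. \<phi> (g t)" "\<lambda>t. \<psi> (g t)"])
    show "nondegenerate_interval J"
      by (simp add: nondegenerate_interval_def J_def is_interval_ball_real)
    show "0 \<in> J" by (simp add: J_def)
  qed (use pos f DERIV_chain2[OF d\<phi> g] DERIV_chain2[OF d\<psi> g] in
      \<open>auto simp: f_def g0 init inv has_real_derivative_iff_has_vector_derivative\<close>)
qed

text \<open>The derivatives of \<open>f\<close>, \<open>1 / f\<close>, \<open>a\<close> and \<open>b\<close> are polynomials in these four functions, so they
  gain regularity together.\<close>

lemma motion_coefficients_Ck_on:
  fixes f a b :: "real \<Rightarrow> real"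
  assumes fp: "\<And>t. t \<in> J \<Longrightarrow> f t > 0"
    and ode: "\<And>t. t \<in> J \<Longrightarrow> (f has_vector_derivative c * (1 / f t)) (at t within J)"
    "\<And>t. t \<in> J \<Longrightarrow>
        (a has_vector_derivative (1 + q * b t) * ((1 / f t) * (1 / f t))) (at t within J)"
    "\<And>t. t \<in> J \<Longrightarrow> (b has_vector_derivative a t * ((1 / f t) * (1 / f t))) (at t within J)"
  shows "Ck_on n J f \<and> Ck_on n J a \<and> Ck_on n J b"
proof -
  have h: "((\<lambda>t. 1 / f t) has_vector_derivative - c * ((1 / f t) * ((1 / f t) * (1 / f t))))
      (at t within J)" if "t \<in> J" for t
    using fp[OF that] ode(1)[OF that]
    unfolding has_real_derivative_iff_has_vector_derivative[symmetric]
    by (auto intro!: derivative_eq_intros)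
  have "Ck_on n J f \<and> Ck_on n J (\<lambda>t. 1 / f t) \<and> Ck_on n J a \<and> Ck_on n J b"
  proof (induction n)
    case 0
    show ?case
      unfolding Ck_on.simps continuous_on_eq_continuous_within
      using ode h by (blast intro: has_vector_derivative_continuous)
  next
    case (Suc n)
    then have IH: "Ck_on n J f" "Ck_on n J (\<lambda>t. 1 / f t)" "Ck_on n J a" "Ck_on n J b" by auto
    show ?case
      by (intro conjI Ck_on_SucI[OF ode(1)] Ck_on_SucI[OF h] Ck_on_SucI[OF ode(2)]
          Ck_on_SucI[OF ode(3)] Ck_on_mult Ck_on_add Ck_on_const IH)
  qed
  then show ?thesis by blast
qed

section \<open>Curves on the light cone\<close>

lemma has_vector_derivative_minkowski_const:
  assumes "nondegenerate_interval L" "s \<in> L" "\<And>s. s \<in> L \<Longrightarrow> \<langle>F s, G s\<rangle> = c"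
    and "(F has_vector_derivative F') (at s within L)"
    and "(G has_vector_derivative G') (at s within L)"
  shows "\<langle>F s, G'\<rangle> + \<langle>F', G s\<rangle> = 0"
proof (rule vector_derivative_unique_within)
  show "at s within L \<noteq> bot"
    by (rule nondegenerate_interval_at_neq_bot[OF assms(1,2)])
  show "((\<lambda>s. \<langle>F s, G s\<rangle>) has_vector_derivative \<langle>F s, G'\<rangle> + \<langle>F', G s\<rangle>) (at s within L)"
    by (rule minkowski.has_vector_derivative[OF assms(4,5)])
  show "((\<lambda>s. \<langle>F s, G s\<rangle>) has_vector_derivative 0) (at s within L)"
    by (rule has_vector_derivative_transform[OF assms(2) assms(3) has_vector_derivative_const])
qed

text \<open>Differentiating the constant pairings of \<open>Z\<close> and \<open>T\<close> gives
  those of \<open>W\<close>; the multiple of \<open>Z\<close> is then chosen so that its sum with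
  \<open>- W\<close> is lightlike. Derivatives enter as arbitrary functions \<open>T\<close>,
  \<open>W\<close>, so that the result also covers reparametrized curves.\<close>

lemma null_curve_frame:
  assumes nd: "nondegenerate_interval L"
    and Z: "\<And>s. s \<in> L \<Longrightarrow> (Z has_vector_derivative T s) (at s within L)"
    and T: "\<And>s. s \<in> L \<Longrightarrow> (T has_vector_derivative W s) (at s within L)"
    and null: "\<And>s. s \<in> L \<Longrightarrow> Z s \<in> light_cone"
    and unit: "\<And>s. s \<in> L \<Longrightarrow> \<langle>T s, T s\<rangle> = 1"
    and s: "s \<in> L"
  shows "null_frame (Z s) (T s) (- (\<langle>W s, W s\<rangle> / 2) *\<^sub>R Z s - W s)"
    and "\<langle>Z s, W s\<rangle> = - 1" and "\<langle>T s, W s\<rangle> = 0"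
    and "associated_curve L Z s = - (\<langle>W s, W s\<rangle> / 2) *\<^sub>R Z s - W s"
    and "curvature L Z s = - (\<langle>W s, W s\<rangle> / 2)"
proof -
  note const = has_vector_derivative_minkowski_const[OF nd]
  have ZZ: "\<langle>Z s, Z s\<rangle> = 0" if "s \<in> L" for s using null[OF that] by (simp add: light_cone_def)
  have ZT: "\<langle>Z s, T s\<rangle> = 0" if "s \<in> L" for s
    using const[OF that ZZ Z[OF that] Z[OF that]] by (simp add: minkowski_commute)
  show ZW: "\<langle>Z s, W s\<rangle> = - 1"
    using const[OF s ZT Z[OF s] T[OF s]] unit[OF s] by simp
  show TW: "\<langle>T s, W s\<rangle> = 0"
    using const[OF s unit T[OF s] T[OF s]] by (simp add: minkowski_commute)
  let ?Y = "- (\<langle>W s, W s\<rangle> / 2) *\<^sub>R Z s - W s"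
  show frame: "null_frame (Z s) (T s) ?Y"
    using ZZ[OF s] ZT[OF s] ZW TW unit[OF s]
    by (auto simp: null_frame_def minkowski_simps minkowski_commute)
  have vT: "unit_tangent L Z s = T s" if "s \<in> L" for s
    unfolding unit_tangent_def velocity_def
    by (rule vector_derivative_within[OF nondegenerate_interval_at_neq_bot[OF nd that] Z[OF that]])
  show assoc: "associated_curve L Z s = ?Y"
    unfolding associated_curve_def vT[OF s]
  proof (rule the_equality)
    show "?Y \<in> light_cone \<and> \<langle>?Y, T s\<rangle> = 0 \<and> \<langle>Z s, ?Y\<rangle> = 1"
      using frame by (auto simp: null_frame_def light_cone_def minkowski.zero_right)
  next
    fix y assume "y \<in> light_cone \<and> \<langle>y, T s\<rangle> = 0 \<and> \<langle>Z s, y\<rangle> = 1"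
    then have "null_frame (Z s) (T s) y"
      using ZZ[OF s] ZT[OF s] unit[OF s] by (simp add: null_frame_def light_cone_def)
    then show "y = ?Y" by (rule null_frame_unique[OF frame])
  qed
  have "vector_derivative (unit_tangent L Z) (at s within L) = W s"
    by (rule vector_derivative_within[OF nondegenerate_interval_at_neq_bot[OF nd s]
          has_vector_derivative_transform[OF s vT T[OF s]]])
  moreover have "Z s \<noteq> 0" using null[OF s] by (simp add: light_cone_def)
  moreover have "W s = \<kappa> *\<^sub>R Z s - ?Y \<longleftrightarrow> (\<kappa> + \<langle>W s, W s\<rangle> / 2) *\<^sub>R Z s = 0" for \<kappa>
    by (simp add: scaleR_left.add)
  ultimately show "curvature L Z s = - (\<langle>W s, W s\<rangle> / 2)"
    unfolding curvature_def assoc by (intro the_equality) auto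
qed

section \<open>The moving frame of a curve parametrized by arc length\<close>

locale arclength_curve =
  fixes I :: "real set" and X :: "real \<Rightarrow> real^3"
  assumes arclength_parametrized: "arclength_parametrized I X"
begin

abbreviation "T \<equiv> unit_tangent I X"
abbreviation "Y \<equiv> associated_curve I X"
abbreviation "k \<equiv> curvature I X"
abbreviation "W \<equiv> velocity I T"

lemma nondegenerate: "nondegenerate_interval I"
  and smooth: "smooth_on I X"
  and null: "s \<in> I \<Longrightarrow> X s \<in> light_cone"
  and unit: "s \<in> I \<Longrightarrow> \<langle>T s, T s\<rangle> = 1"
  using arclength_parametrized
  by (auto simp: arclength_parametrized_def spacelike_curve_def unit_tangent_def)

lemma smooth_T: "smooth_on I T" and smooth_W: "smooth_on I W"
proof -
  show "smooth_on I T"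
    unfolding unit_tangent_def velocity_def using smooth nondegenerate
    by (rule smooth_on_vector_derivative)
  then show "smooth_on I W"
    unfolding velocity_def using nondegenerate by (rule smooth_on_vector_derivative)
qed

lemma X_has_derivative: "s \<in> I \<Longrightarrow> (X has_vector_derivative T s) (at s within I)"
  and T_has_derivative: "s \<in> I \<Longrightarrow> (T has_vector_derivative W s) (at s within I)"
  using smooth_on_has_vector_derivative[OF smooth nondegenerate]
    smooth_on_has_vector_derivative[OF smooth_T nondegenerate]
  by (simp_all add: unit_tangent_def velocity_def)

lemma k_eq: "s \<in> I \<Longrightarrow> k s = - (\<langle>W s, W s\<rangle> / 2)"
  and Y_eq: "s \<in> I \<Longrightarrow> Y s = k s *\<^sub>R X s - W s"
  and frame: "s \<in> I \<Longrightarrow> null_frame (X s) (T s) (Y s)"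
  using null_curve_frame[OF nondegenerate X_has_derivative T_has_derivative null unit, of s]
  by simp_all

text \<open>The volume is continuous with square 1, hence takes finitely many values and is constant
  on the interval. \<open>D\<close> is its negative, the sign coming from
  \<open>null_frame_lorentz_cross\<close>.\<close>

lemma volume_constant:
  obtains D where "D\<^sup>2 = 1" "\<And>s w. s \<in> I \<Longrightarrow> \<langle>lorentz_cross w (X s), Y s\<rangle> = D * \<langle>T s, w\<rangle>"
proof -
  define d where "d s = \<langle>lorentz_cross (X s) (T s), Y s\<rangle>" for s
  \<comment> \<open>The multiple of \<open>X\<close> in \<open>Y\<close> is orthogonal to the cross
    product and drops out, which leaves an expression in smooth functions only.\<close>
  have d: "d s = - \<langle>lorentz_cross (X s) (T s), W s\<rangle>" if "s \<in> I" for s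
    by (simp add: d_def Y_eq that minkowski_simps lorentz_cross_orthogonal)
  have sq: "(d s)\<^sup>2 = 1" if "s \<in> I" for s
    unfolding d_def by (rule null_frame_volume[OF frame[OF that]])
  have "continuous_on I Z" if "smooth_on I Z" for Z :: "real \<Rightarrow> real^3"
    using that unfolding smooth_on_def by (metis Ck_on.simps(1))
  then have "continuous_on I (\<lambda>s. - \<langle>lorentz_cross (X s) (T s), W s\<rangle>)"
    using smooth smooth_T smooth_W
    by (intro continuous_on_minus minkowski.continuous_on
        bounded_bilinear.continuous_on[OF bounded_bilinear_lorentz_cross]) auto
  then have "continuous_on I d" using d by (simp cong: continuous_on_cong)
  moreover have "d ` I \<subseteq> {1, - 1}" using sq by (auto simp: power2_eq_1_iff)
  then have "finite (d ` I)" by (rule finite_subset) simp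
  moreover have "connected I"
    using nondegenerate by (simp add: nondegenerate_interval_def is_interval_connected)
  ultimately have "d constant_on I" by (intro continuous_finite_range_constant)
  then obtain e where e: "\<And>s. s \<in> I \<Longrightarrow> d s = e" by (auto simp: constant_on_def)
  obtain s where "s \<in> I" using nondegenerate interior_subset by (fastforce simp: nondegenerate_interval_def)
  then have "e\<^sup>2 = 1" using sq e by metis
  then show thesis
    using null_frame_lorentz_cross[OF frame] e by (intro that[of "- e"]) (auto simp: d_def)
qed

section \<open>Scaled Lorentz images of the curve\<close>

lemma homothetic_curve_velocity:
  assumes "M \<in> O13" "s \<in> I"
  shows "velocity I (\<lambda>s. c *\<^sub>R (M *v X s)) s = c *\<^sub>R (M *v T s)"
  unfolding velocity_def
  by (rule vector_derivative_within[OF nondegenerate_interval_at_neq_bot[OF nondegenerate assms(2)]])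
    (intro bounded_linear.has_vector_derivative[OF bounded_linear_scaleR_right]
      bounded_linear.has_vector_derivative[OF matrix_vector_mul_bounded_linear]
      X_has_derivative assms(2))

lemma homothetic_curve_arclength:
  assumes "M \<in> O13" "f > 0" "u \<in> I"
  shows "arclength I (\<lambda>s. f *\<^sub>R (M *v X s)) u = f * (u - (SOME a. a \<in> I))"
proof -
  let ?a = "SOME a. a \<in> I" and ?Z = "\<lambda>s. f *\<^sub>R (M *v X s)"
  have a: "?a \<in> I" using assms(3) by (rule someI)
  have speed: "sqrt \<langle>velocity I ?Z w, velocity I ?Z w\<rangle> = f" if "w \<in> I" for w
    unfolding homothetic_curve_velocity[OF assms(1) that]
    using assms(1,2) unit[OF that] by (simp add: minkowski_simps O13_minkowski)
  \<comment> \<open>The speed is known only on \<open>I\<close>, and the base point may lie on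
    either side of \<open>u\<close>; convexity keeps the range of integration inside
    \<open>I\<close>.\<close>
  have "w \<in> I" if "w \<in> einterval (min (ereal ?a) (ereal u)) (max (ereal ?a) (ereal u))" for w
  proof -
    have "min ?a u < w" "w < max ?a u"
      using that by (auto simp: einterval_iff min_def max_def split: if_splits)
    moreover have "min ?a u \<in> I" "max ?a u \<in> I"
      using a assms(3) by (simp_all add: min_def max_def)
    ultimately show ?thesis
      using nondegenerate mem_is_interval_1_I[of I "min ?a u" "max ?a u" w]
      by (simp add: nondegenerate_interval_def)
  qed
  then have "(LBINT w=?a..u. sqrt \<langle>velocity I ?Z w, velocity I ?Z w\<rangle>) = (LBINT w=?a..u. f)"
    by (rule interval_integral_cong[OF speed])
  then show ?thesis by (simp add: arclength_def)
qed

text \<open>In its own arc length the image curve has velocity \<open>M T\<close> and acceleration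
  \<open>M W / f\<close>. Inserting these into the formulas of \<open>null_curve_frame\<close> gives
  the powers of \<open>f\<close>.\<close>

lemma homothetic_curve_frame:
  assumes M: "M \<in> O13" and f: "f > 0" and u: "u \<in> I"
  shows "associated_curve_param I (\<lambda>s. f *\<^sub>R (M *v X s)) u = (1 / f) *\<^sub>R (M *v Y u)"
    and "curvature_param I (\<lambda>s. f *\<^sub>R (M *v X s)) u = k u / f\<^sup>2"
proof -
  define a where "a = (SOME a. a \<in> I)"
  define l where "l = arclength I (\<lambda>s. f *\<^sub>R (M *v X s))"
  define Z where "Z = arclength_reparam I (\<lambda>s. f *\<^sub>R (M *v X s))"
  let ?L = "l ` I"
  have l: "l s = f * (s - a)" if "s \<in> I" for s
    unfolding l_def a_def by (rule homothetic_curve_arclength[OF M f that])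
  have inv: "l s / f + a = s" if "s \<in> I" for s using l[OF that] f by simp
  have inj: "inj_on l I" using inv by (metis inj_onI)
  have L: "(\<lambda>\<sigma>. \<sigma> / f + a) ` ?L \<subseteq> I" using inv by auto
  have Z_eq: "Z \<sigma> = f *\<^sub>R (M *v X (\<sigma> / f + a))" if "\<sigma> \<in> ?L" for \<sigma>
    using that inv the_inv_into_f_f[OF inj] by (auto simp: Z_def arclength_reparam_def l_def)
  have nd: "nondegenerate_interval ?L"
  proof -
    have L_eq: "?L = (\<lambda>s. f *\<^sub>R s + - (f * a)) ` I"
      using l by (auto simp: algebra_simps intro!: image_cong)
    have "is_interval ?L"
      using nondegenerate unfolding L_eq nondegenerate_interval_def is_interval_connected_1
      by (intro connected_continuous_image) (auto intro!: continuous_intros)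
    moreover have "interior ?L \<noteq> {}"
    proof -
      have "open ((\<lambda>s. f *\<^sub>R s + - (f * a)) ` interior I)"
        using open_affinity[OF open_interior, of f "- (f * a)" I] f by (simp add: add.commute)
      then have "(\<lambda>s. f *\<^sub>R s + - (f * a)) ` interior I \<subseteq> interior ?L"
        unfolding L_eq by (intro interior_maximal image_mono interior_subset)
      then show ?thesis using nondegenerate by (auto simp: nondegenerate_interval_def)
    qed
    ultimately show ?thesis by (simp add: nondegenerate_interval_def)
  qed
  note affine = has_vector_derivative_rescale[OF _ L]
  note linear = bounded_linear.has_vector_derivative[OF matrix_vector_mul_bounded_linear[of M]]
  have dZ: "(Z has_vector_derivative M *v T (\<sigma> / f + a)) (at \<sigma> within ?L)" if "\<sigma> \<in> ?L" for \<sigma>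
  proof -
    have "\<sigma> / f + a \<in> I" using that L by blast
    note bounded_linear.has_vector_derivative[OF bounded_linear_scaleR_right
        linear[OF affine[OF X_has_derivative[OF this]]], of f]
    then have "((\<lambda>\<sigma>. f *\<^sub>R (M *v X (\<sigma> / f + a))) has_vector_derivative M *v T (\<sigma> / f + a))
        (at \<sigma> within ?L)"
      using f by (simp add: matrix_vector_mult_scaleR)
    then show ?thesis by (intro has_vector_derivative_transform[OF that Z_eq])
  qed
  have dT: "((\<lambda>\<sigma>. M *v T (\<sigma> / f + a)) has_vector_derivative (1 / f) *\<^sub>R (M *v W (\<sigma> / f + a)))
      (at \<sigma> within ?L)" if "\<sigma> \<in> ?L" for \<sigma>
  proof -
    have "\<sigma> / f + a \<in> I" using that L by blast
    from linear[OF affine[OF T_has_derivative[OF this]]] show ?thesis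
      by (simp add: matrix_vector_mult_scaleR)
  qed
  have Z_null: "Z \<sigma> \<in> light_cone" if "\<sigma> \<in> ?L" for \<sigma>
    unfolding Z_eq[OF that] using L f that by (intro O13_light_cone[OF M] null) auto
  have T_unit: "\<langle>M *v T (\<sigma> / f + a), M *v T (\<sigma> / f + a)\<rangle> = 1" if "\<sigma> \<in> ?L" for \<sigma>
    unfolding O13_minkowski[OF M] using unit L that by blast
  have lu: "l u \<in> ?L" using u by simp
  note frame_Z = null_curve_frame(4,5)[OF nd dZ dT Z_null T_unit lu]
  have "Z (l u) = f *\<^sub>R (M *v X u)" using Z_eq[OF lu] inv[OF u] by simp
  moreover have "\<langle>W u, W u\<rangle> = - 2 * k u" using k_eq[OF u] by simp
  ultimately have "associated_curve ?L Z (l u) = (1 / f) *\<^sub>R (M *v Y u)"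
    "curvature ?L Z (l u) = k u / f\<^sup>2"
    using frame_Z[unfolded inv[OF u]] f
    by (simp_all add: minkowski_simps O13_minkowski[OF M] Y_eq[OF u] power2_eq_square
        matrix_vector_mult_diff_distrib matrix_vector_mult_scaleR scaleR_diff_right)
  then show "associated_curve_param I (\<lambda>s. f *\<^sub>R (M *v X s)) u = (1 / f) *\<^sub>R (M *v Y u)"
    "curvature_param I (\<lambda>s. f *\<^sub>R (M *v X s)) u = k u / f\<^sup>2"
    by (simp_all add: associated_curve_param_def curvature_param_def l_def Z_def)
qed

text \<open>The velocity in time is \<open>f M' X + f' M X\<close>. Pair it with
  \<open>M Y / f\<close>, use that \<open>M\<close> preserves
  \<open>\<langle>X, Y\<rangle> = 1\<close>, and multiply by \<open>f\<^sup>2\<close>.\<close>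

lemma homothetic_motion_CF_iff:
  assumes J: "nondegenerate_interval J" "t \<in> J" and u: "u \<in> I" and Mf: "M t \<in> O13" "f t > 0"
    and f: "(f has_vector_derivative f') (at t within J)"
    and M: "(M has_vector_derivative M') (at t within J)"
  shows "(\<langle>vector_derivative (\<lambda>\<tau>. f \<tau> *\<^sub>R (M \<tau> *v X u)) (at t within J),
        associated_curve_param I (\<lambda>s. f t *\<^sub>R (M t *v X s)) u\<rangle>
        = curvature_param I (\<lambda>s. f t *\<^sub>R (M t *v X s)) u)
    \<longleftrightarrow> f t * f' + (f t)\<^sup>2 * \<langle>M' *v X u, M t *v Y u\<rangle> = k u" (is "?CF \<longleftrightarrow> _")
proof -
  have "((\<lambda>\<tau>. M \<tau> *v X u) has_vector_derivative M' *v X u) (at t within J)"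
    using bounded_bilinear.has_vector_derivative[OF bounded_bilinear_matrix_vector_mult M
        has_vector_derivative_const[of "X u"]] by simp
  from bounded_bilinear.has_vector_derivative[OF bounded_bilinear_scaleR f this]
  have "vector_derivative (\<lambda>\<tau>. f \<tau> *\<^sub>R (M \<tau> *v X u)) (at t within J)
      = f t *\<^sub>R (M' *v X u) + f' *\<^sub>R (M t *v X u)"
    by (rule vector_derivative_within[OF nondegenerate_interval_at_neq_bot[OF J]])
  moreover have "\<langle>X u, Y u\<rangle> = 1" using frame[OF u] by (simp add: null_frame_def)
  ultimately have "?CF \<longleftrightarrow> f' / f t + \<langle>M' *v X u, M t *v Y u\<rangle> = k u / (f t)\<^sup>2"
    using Mf(2)
    by (simp add: homothetic_curve_frame[OF Mf u] minkowski_simps O13_minkowski[OF Mf(1)]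
        add_divide_distrib add.commute)
  also have "\<dots> \<longleftrightarrow> (f' / f t + \<langle>M' *v X u, M t *v Y u\<rangle>) * (f t)\<^sup>2 = k u"
    using Mf(2) by (simp add: eq_divide_eq)
  also have "(f' / f t + \<langle>M' *v X u, M t *v Y u\<rangle>) * (f t)\<^sup>2
      = f t * f' + (f t)\<^sup>2 * \<langle>M' *v X u, M t *v Y u\<rangle>"
    using Mf(2) by (simp add: distrib_right power2_eq_square)
  finally show ?thesis .
qed

section \<open>From a self-similar motion to the soliton equation\<close>

lemma constant_curvature_imp_planar:
  assumes k: "\<And>s. s \<in> I \<Longrightarrow> k s = c"
  obtains v where "v \<noteq> 0" "\<And>s. s \<in> I \<Longrightarrow> \<langle>T s, v\<rangle> = 0"
proof -
  note const = has_vector_derivative_minkowski_const[OF nondegenerate]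
  \<comment> \<open>This is \<open>k X + Y\<close> with \<open>Y\<close> expressed through
    \<open>W\<close>, whose derivative is available.\<close>
  define V where "V s = (2 * c) *\<^sub>R X s - W s" for s
  have V_Y: "V s = c *\<^sub>R X s + Y s" if "s \<in> I" for s
    using that scaleR_add_left[of c c "X s"] by (simp add: V_def Y_eq k)
  have "(V has_vector_derivative 0) (at s within I)" if s: "s \<in> I" for s
  proof -
    obtain U where U: "(W has_vector_derivative U) (at s within I)"
      using smooth_on_has_vector_derivative[OF smooth_W nondegenerate s] by blast
    have XW: "\<langle>X s, W s\<rangle> = - 1" and TW: "\<langle>T s, W s\<rangle> = 0" if "s \<in> I" for s
      using null_curve_frame(2,3)[OF nondegenerate X_has_derivative T_has_derivative null unit that]
      by auto
    have WW: "\<langle>W s, W s\<rangle> = - 2 * c" if "s \<in> I" for s using k_eq[OF that] k[OF that] by simp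
    have "\<langle>X s, U\<rangle> = 0"
      using const[OF s XW X_has_derivative[OF s] U] TW[OF s] by simp
    moreover have "\<langle>T s, U\<rangle> = 2 * c"
      using const[OF s TW T_has_derivative[OF s] U] WW[OF s] by simp
    moreover have "\<langle>W s, U\<rangle> = 0"
      using const[OF s WW U U] by (simp add: minkowski_commute)
    \<comment> \<open>\<open>U\<close> and \<open>(2 * c) *\<^sub>R T s\<close> have the same
      pairings with the null frame.\<close>
    ultimately have "U - (2 * c) *\<^sub>R T s = 0"
      using frame[OF s] TW[OF s] unfolding null_frame_def
      by (intro null_frame_orthogonal_imp_zero[OF frame[OF s]])
        (simp_all add: minkowski_simps minkowski_commute Y_eq[OF s])
    moreover have "(V has_vector_derivative (2 * c) *\<^sub>R T s - U) (at s within I)"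
      unfolding V_def using X_has_derivative[OF s] U
      by (auto intro!: derivative_eq_intros)
    ultimately show ?thesis by (simp add: algebra_simps)
  qed
  moreover have "convex I"
    using nondegenerate by (simp add: nondegenerate_interval_def is_interval_convex)
  ultimately obtain v where v: "\<And>s. s \<in> I \<Longrightarrow> V s = v"
    using has_vector_derivative_zero_constant by blast
  show thesis
  proof
    show "\<langle>T s, v\<rangle> = 0" if "s \<in> I" for s
      using frame[OF that] V_Y[OF that]
      by (simp add: v[OF that] null_frame_def minkowski_simps minkowski_commute)
    obtain s where s: "s \<in> I"
      using nondegenerate interior_subset by (fastforce simp: nondegenerate_interval_def)
    have "\<langle>X s, v\<rangle> = 1"
      using frame[OF s] V_Y[OF s]
      by (simp add: v[OF s] null_frame_def minkowski_simps minkowski_commute)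
    then show "v \<noteq> 0" by (auto simp: minkowski.zero_right)
  qed
qed

text \<open>At time 0, where \<open>f\<close> and \<open>M\<close> are trivial, the flow equation
  reads \<open>c + \<langle>A X, Y\<rangle> = k\<close> with \<open>c = f'(0)\<close> and
  \<open>A = M'(0)\<close>. Differentiating the invariance of the metric under \<open>M\<close>
  shows that \<open>A\<close> is skew.\<close>

lemma self_similar_solution_imp_soliton_equation:
  assumes "self_similar_solution I X"
  obtains v c where "v \<noteq> 0" "\<And>s. s \<in> I \<Longrightarrow> c + \<langle>T s, v\<rangle> = k s"
proof -
  obtain J f M where *: "self_similar_motion I X J f M"
    using assms by (auto simp: self_similar_solution_def)
  then have J: "nondegenerate_interval J" "0 \<in> J"
    and f: "smooth_on J f" "f 0 = 1" and M: "smooth_on J M" "M 0 = mat 1"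
    and O: "\<And>t. t \<in> J \<Longrightarrow> M t \<in> O13"
    and CF: "\<And>u. u \<in> I \<Longrightarrow> \<langle>vector_derivative (\<lambda>\<tau>. f \<tau> *\<^sub>R (M \<tau> *v X u)) (at 0 within J),
        associated_curve_param I (\<lambda>s. f 0 *\<^sub>R (M 0 *v X s)) u\<rangle>
        = curvature_param I (\<lambda>s. f 0 *\<^sub>R (M 0 *v X s)) u"
    by (auto simp: self_similar_motion_def CF_solution_def future_cone_isometries_def)
  obtain c where c: "(f has_vector_derivative c) (at 0 within J)"
    using smooth_on_has_vector_derivative[OF f(1) J] by blast
  obtain A where A: "(M has_vector_derivative A) (at 0 within J)"
    using smooth_on_has_vector_derivative[OF M(1) J] by blast
  have "\<langle>A *v x, y\<rangle> = - \<langle>x, A *v y\<rangle>" for x y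
  proof -
    have d: "((\<lambda>\<tau>. M \<tau> *v z) has_vector_derivative A *v z) (at 0 within J)" for z
      using bounded_bilinear.has_vector_derivative[OF bounded_bilinear_matrix_vector_mult A
          has_vector_derivative_const[of z]] by simp
    show ?thesis
      using has_vector_derivative_minkowski_const[OF J O13_minkowski[OF O] d d, of x y] M(2)
      by simp
  qed
  then obtain w where w: "\<And>x. A *v x = lorentz_cross w x" by (rule skew_imp_lorentz_cross) blast
  obtain D where D: "D\<^sup>2 = 1" "\<And>s w. s \<in> I \<Longrightarrow> \<langle>lorentz_cross w (X s), Y s\<rangle> = D * \<langle>T s, w\<rangle>"
    by (rule volume_constant) blast
  have eq: "c + \<langle>T s, D *\<^sub>R w\<rangle> = k s" if "s \<in> I" for s
    using homothetic_motion_CF_iff[OF J that O[OF J(2)] _ c A] CF[OF that] f(2) M(2)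
    by (simp add: w D(2)[OF that] minkowski_simps)
  show thesis
  proof (cases "w = 0")
    case False
    moreover have "D \<noteq> 0" using D(1) by auto
    ultimately show ?thesis using eq by (intro that[of "D *\<^sub>R w" c]) auto
  next
    case True
    then have k: "k s = c" if "s \<in> I" for s
      using eq[OF that] by (simp add: minkowski.zero_right)
    obtain v where "v \<noteq> 0" "\<forall>s\<in>I. \<langle>T s, v\<rangle> = 0"
      using constant_curvature_imp_planar[OF k] by metis
    then show ?thesis using k by (intro that[of v c]) auto
  qed
qed

section \<open>From the soliton equation to a self-similar motion\<close>

text \<open>Since \<open>f\<^sup>2 M' = M A\<close> and \<open>M\<close> preserves the metric, the
  flow equation at every time reduces to \<open>f f' + \<langle>A X, Y\<rangle> = k\<close>, whose
  left side is \<open>c + \<langle>T, v\<rangle>\<close>.\<close>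

lemma soliton_equation_imp_self_similar_motion:
  assumes future: "X ` I \<subseteq> future_light_cone"
    and v: "\<And>s. s \<in> I \<Longrightarrow> c + \<langle>T s, v\<rangle> = k s"
  obtains J f M where "self_similar_motion I X J f M" "c = 0 \<Longrightarrow> \<forall>t\<in>J. f t = 1"
proof -
  obtain D where D: "D\<^sup>2 = 1" "\<And>s w. s \<in> I \<Longrightarrow> \<langle>lorentz_cross w (X s), Y s\<rangle> = D * \<langle>T s, w\<rangle>"
    by (rule volume_constant) blast
  \<comment> \<open>As \<open>D\<^sup>2 = 1\<close>, this choice turns
    \<open>D * \<langle>T s, w\<rangle>\<close> into
    \<open>\<langle>T s, v\<rangle>\<close>.\<close>
  define w where "w = D *\<^sub>R v"
  define A where "A = matrix (lorentz_cross w)"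
  have A: "A *v x = lorentz_cross w x" for x
    using linear_lorentz_cross by (simp add: A_def)
  obtain J f a b where J: "nondegenerate_interval J" "0 \<in> J"
    and fp: "\<And>t. t \<in> J \<Longrightarrow> f t > 0" and init: "f 0 = 1" "a 0 = 0" "b 0 = 0"
    and f1: "c = 0 \<Longrightarrow> \<forall>t\<in>J. f t = 1"
    and inv: "\<And>t. t \<in> J \<Longrightarrow> 2 * b t - (a t)\<^sup>2 + \<langle>w, w\<rangle> * (b t)\<^sup>2 = 0"
    and ode: "\<And>t. t \<in> J \<Longrightarrow> (f has_vector_derivative c * (1 / f t)) (at t within J)"
    "\<And>t. t \<in> J \<Longrightarrow>
        (a has_vector_derivative (1 + \<langle>w, w\<rangle> * b t) * ((1 / f t) * (1 / f t))) (at t within J)"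
    "\<And>t. t \<in> J \<Longrightarrow> (b has_vector_derivative a t * ((1 / f t) * (1 / f t))) (at t within J)"
    by (rule exists_motion_coefficients[of c "\<langle>w, w\<rangle>"]) blast
  define M where "M t = mat 1 + a t *\<^sub>R A + b t *\<^sub>R (A ** A)" for t
  have M: "M t *v x = x + a t *\<^sub>R lorentz_cross w x
      + b t *\<^sub>R lorentz_cross w (lorentz_cross w x)" for t x
    by (simp add: M_def A matrix_vector_mult_add_rdistrib flip: scaleR_matrix_vector_assoc
        matrix_vector_mul_assoc)
  have smooth_coeffs: "Ck_on n J f" "Ck_on n J a" "Ck_on n J b" for n
    using motion_coefficients_Ck_on[OF fp ode] by auto
  have "Ck_on n J M" for n
    unfolding M_def by (intro Ck_on_add Ck_on_scaleR Ck_on_const smooth_coeffs)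
  then have smooth_M: "smooth_on J M" by (simp add: smooth_on_def)
  have smooth_f: "smooth_on J f" using smooth_coeffs(1) by (simp add: smooth_on_def)
  have O: "M t \<in> O13" if "t \<in> J" for t
  proof -
    \<comment> \<open>Skewness moves every \<open>A\<close> to the right: the odd powers cancel, and
      the fourth power becomes \<open>\<langle>w, w\<rangle>\<close> times the second. What remains
      is the conserved quantity.\<close>
    have "\<langle>M t *v x, M t *v y\<rangle> = \<langle>x, y\<rangle>
        + (2 * b t - (a t)\<^sup>2 + \<langle>w, w\<rangle> * (b t)\<^sup>2) * \<langle>x, lorentz_cross w (lorentz_cross w y)\<rangle>" for x y
      unfolding M
      by (simp add: minkowski_simps lorentz_cross_skew lorentz_cross_cube)
        (simp add: algebra_simps power2_eq_square)
    then show ?thesis using inv[OF that] by (simp add: O13_def)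
  qed
  have M0: "M 0 = mat 1" by (simp add: M_def init)
  have isom: "M t \<in> future_cone_isometries" if "t \<in> J" for t
  proof (rule O13_path_future_cone_isometry[where M = M and J = J, OF O _ M0 _ J(2) that])
    show "continuous_on J M" using smooth_M unfolding smooth_on_def by (metis Ck_on.simps(1))
    show "connected J"
      using J by (simp add: nondegenerate_interval_def is_interval_connected)
  qed
  have X_future: "f t *\<^sub>R (M t *v X s) \<in> future_light_cone" if "t \<in> J" "s \<in> I" for t s
  proof -
    have "M t *v X s \<in> future_light_cone"
      using isom[OF that(1)] future that(2) by (auto simp: future_cone_isometries_def)
    then show ?thesis
      using fp[OF that(1)] by (auto simp: future_light_cone_def light_cone_def minkowski_simps)
  qed
  have "spacelike_curve I (\<lambda>s. f t *\<^sub>R (M t *v X s))" if t: "t \<in> J" for t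
    unfolding spacelike_curve_def
  proof (intro conjI nondegenerate ballI)
    show "smooth_on I (\<lambda>s. f t *\<^sub>R (M t *v X s))"
      using smooth unfolding smooth_on_def
      by (intro allI Ck_on_scaleR Ck_on_const
          bounded_linear.Ck_on[OF matrix_vector_mul_bounded_linear]) auto
    show "(\<lambda>s. f t *\<^sub>R (M t *v X s)) ` I \<subseteq> light_cone"
      using X_future[OF t] by (auto simp: future_light_cone_def)
    show "\<langle>velocity I (\<lambda>s. f t *\<^sub>R (M t *v X s)) s, velocity I (\<lambda>s. f t *\<^sub>R (M t *v X s)) s\<rangle> > 0"
      if "s \<in> I" for s
      unfolding homothetic_curve_velocity[OF O[OF t] that]
      using fp[OF t] by (simp add: minkowski_simps O13_minkowski[OF O[OF t]] unit[OF that])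
  qed
  moreover have "smooth_on (I \<times> J) (\<lambda>(s, t). f t *\<^sub>R (M t *v X s))"
    unfolding smooth_on_def case_prod_beta
  proof
    fix n
    have "Ck_on n (I \<times> J) (\<lambda>p. f (snd p))" "Ck_on n (I \<times> J) (\<lambda>p. M (snd p))"
      "Ck_on n (I \<times> J) (\<lambda>p. X (fst p))"
      using smooth_f smooth_M smooth unfolding smooth_on_def
      by (auto intro!: bounded_linear.Ck_on_compose[OF bounded_linear_snd, of _ J]
          bounded_linear.Ck_on_compose[OF bounded_linear_fst, of _ I])
    then show "Ck_on n (I \<times> J) (\<lambda>p. f (snd p) *\<^sub>R (M (snd p) *v X (fst p)))"
      by (intro Ck_on_scaleR bounded_bilinear.Ck_on[OF bounded_bilinear_matrix_vector_mult])
  qed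
  moreover have "\<langle>vector_derivative (\<lambda>\<tau>. f \<tau> *\<^sub>R (M \<tau> *v X s)) (at t within J),
        associated_curve_param I (\<lambda>s. f t *\<^sub>R (M t *v X s)) s\<rangle>
        = curvature_param I (\<lambda>s. f t *\<^sub>R (M t *v X s)) s" if t: "t \<in> J" and s: "s \<in> I" for t s
  proof -
    let ?M' = "((1 + \<langle>w, w\<rangle> * b t) * ((1 / f t) * (1 / f t))) *\<^sub>R A
        + (a t * ((1 / f t) * (1 / f t))) *\<^sub>R (A ** A)"
    have dM: "(M has_vector_derivative ?M') (at t within J)"
      unfolding M_def
      by (rule derivative_eq_intros refl ode(2,3)[OF t,
            folded has_real_derivative_iff_has_vector_derivative] | simp)+
    \<comment> \<open>By the cube identity, \<open>A + a A\<^sup>2 + b A\<^sup>3\<close> equals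
      \<open>(1 + \<langle>w, w\<rangle> b) A + a A\<^sup>2\<close>.\<close>
    have "(f t)\<^sup>2 *\<^sub>R (?M' *v X s) = M t *v lorentz_cross w (X s)"
      using fp[OF t]
      by (simp add: M A matrix_vector_mult_add_rdistrib lorentz_cross_cube scaleR_add_left
          power2_eq_square algebra_simps flip: scaleR_matrix_vector_assoc matrix_vector_mul_assoc)
    then have "(f t)\<^sup>2 * \<langle>?M' *v X s, M t *v Y s\<rangle> = \<langle>lorentz_cross w (X s), Y s\<rangle>"
      by (metis O13_minkowski[OF O[OF t]] minkowski.scaleR_left real_scaleR_def)
    moreover have "\<langle>lorentz_cross w (X s), Y s\<rangle> = \<langle>T s, v\<rangle>"
      using D(1) by (simp add: D(2)[OF s] w_def minkowski_simps power2_eq_square)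
    ultimately show ?thesis
      using homothetic_motion_CF_iff[of J t s M f, OF J(1) t s O[OF t] fp[OF t] ode(1)[OF t] dM]
        fp[OF t] v[OF s] by simp
  qed
  ultimately have "CF_solution I J X (\<lambda>t s. f t *\<^sub>R (M t *v X s))"
    using J X_future init(1) M0 by (auto simp: CF_solution_def)
  then have "self_similar_motion I X J f M"
    using fp init(1) M0 smooth_f smooth_M isom by (simp add: self_similar_motion_def)
  then show thesis using f1 by (rule that)
qed

end

theorem theorem1p5:
  fixes I :: "real set" and X :: "real \<Rightarrow> real^3"
  assumes "arclength_parametrized I X"
    and "X ` I \<subseteq> future_light_cone"
  shows "(self_similar_solution I X \<longleftrightarrow>
            (\<exists>v c. v \<noteq> 0 \<and> (\<forall>s\<in>I. c + \<langle>unit_tangent I X s, v\<rangle> = curvature I X s)))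
       \<and> (\<forall>v c. v \<noteq> 0 \<and> (\<forall>s\<in>I. c + \<langle>unit_tangent I X s, v\<rangle> = curvature I X s) \<and> c = 0
            \<longrightarrow> soliton_solution I X)"
proof -
  interpret arclength_curve I X by unfold_locales (rule assms(1))
  \<comment> \<open>One construction serves both claims, since its scaling is identically 1 when
    \<open>c = 0\<close>.\<close>
  have "\<exists>J f M. self_similar_motion I X J f M \<and> (c = 0 \<longrightarrow> (\<forall>t\<in>J. f t = 1))"
    if "\<forall>s\<in>I. c + \<langle>T s, v\<rangle> = k s" for v c
    using soliton_equation_imp_self_similar_motion[OF assms(2), of c v] that by metis
  moreover have "\<exists>v c. v \<noteq> 0 \<and> (\<forall>s\<in>I. c + \<langle>T s, v\<rangle> = k s)" if "self_similar_solution I X"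
    using self_similar_solution_imp_soliton_equation[OF that] by metis
  ultimately show ?thesis
    unfolding self_similar_solution_def soliton_solution_def by metis
qed

end
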